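(* Let $m>1$ be an integer. For each prime power $q$ with $q\,\|\,m$ let $r_q\ge 0$ be an integer and let $\mathbf v_{q,1},\ldots,\mathbf v_{q,r_q}\in(\mathbb{Z}_q)^n$, and set $r=\sum_{q\|m} r_q$. Then the number of solutions $\mathbf x\in B^n$ of the system \[ \mathbf v_{q,i}^T\mathbf x= 0 \text{ in } \mathbb{Z}_q,\qquad 1\le i\le r_q,\ q\,\|\,m, \] is at least $2$ if $n\ge mr\log m$, and is at least $2^{\,n-mr\log m\log n}$.
   Context: $B=\{0,1\}\subseteq\mathbb{Z}$. For a prime power $q=p^a$, $q\,\|\,m$ means $p^a\mid m$ but $p^{a+1}\nmid m$.
   Formalization: With log natural, the formal statement assumes n ≥ 1 (log 0 is undefined; at n = r = 0 there is one solution) and drops the second bound, false in general, for n = 1, r ≥ 1 (v = (1) has only x = 0) and for n = m = 2, r = 1 or 2 (v = (1,1); unit vectors). *)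

theory Defs
  imports Complex_Main "HOL-Number_Theory.Number_Theory" "HOL-Library.FuncSet"
begin

definition exactly_divides :: "nat \<Rightarrow> nat \<Rightarrow> bool"  (infix "\<parallel>" 50)
  where "q \<parallel> m \<longleftrightarrow>
    (\<exists>p a. prime p \<and> a \<ge> 1 \<and> q = p ^ a \<and> p ^ a dvd m \<and> \<not> p ^ (a + 1) dvd m)"

text \<open>
  The vector of index \<open>(q, i)\<close> over the integers mod \<open>q\<close> is given by arbitrary integer
  representatives \<open>v q i j\<close> of its coordinates, \<open>1 \<le> j \<le> n\<close>. Points of \<open>{0,1}\<^sup>n\<close> are
  extensional functions on \<open>{1..n}\<close>, so that \<open>card\<close> counts each of them once.
\<close>

definition solutions ::
  "nat \<Rightarrow> nat \<Rightarrow> (nat \<Rightarrow> nat) \<Rightarrow> (nat \<Rightarrow> nat \<Rightarrow> nat \<Rightarrow> int) \<Rightarrow> (nat \<Rightarrow> int) set"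
  where "solutions m n rq v =
    {x \<in> {1..n} \<rightarrow>\<^sub>E {0, 1}.
       \<forall>q. q \<parallel> m \<longrightarrow> (\<forall>i\<in>{1..rq q}. [(\<Sum>j=1..n. v q i j * x j) = 0] (mod int q))}"

end

theory Submission
  imports Defs "HOL-Library.Real_Mod" "HOL-Analysis.Harmonic_Numbers"
begin

text \<open>
  After scaling, all \<open>r\<close> congruences are modulo \<open>m\<close>, so they state that a subset of the columns
  sums to zero in \<open>G = (\<int>/m)\<^sup>r\<close>. If there are at least \<open>m * ln |G|\<close> columns, a nonempty zero-sum
  subset exists, by a character argument on the group ring of \<open>G\<close>. Olson's halving argument
  then amplifies this to \<open>2 powr (n - m * ln |G|)\<close> solutions, which is more than required as
  soon as \<open>ln n \<ge> 1\<close>; for \<open>n = 2\<close> and \<open>r > 0\<close> the required exponent is not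
  positive outside the excluded cases.
\<close>

section \<open>Additive characters of \<int>/m, evaluated at integer representatives\<close>

definition root_char :: "nat \<Rightarrow> int \<Rightarrow> complex"
  where "root_char m z = cis (2 * pi * real_of_int z / real m)"

lemma root_char_0 [simp]: "root_char m 0 = 1"
  by (simp add: root_char_def)

lemma root_char_nonzero [simp]: "root_char m z \<noteq> 0"
  by (simp add: root_char_def)

lemma root_char_add: "root_char m (a + b) = root_char m a * root_char m b"
  by (simp add: root_char_def cis_mult ring_distribs add_divide_distrib)

lemma root_char_sum: "root_char m (\<Sum>x\<in>A. f x) = (\<Prod>x\<in>A. root_char m (f x))"
  by (induction A rule: infinite_finite_induct) (simp_all add: root_char_add)

lemma root_char_power: "root_char m (int u * s) = root_char m s ^ u"
  by (induction u) (simp_all add: root_char_add ring_distribs)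

lemma root_char_eq_1_iff:
  assumes "m > 0"
  shows "root_char m z = 1 \<longleftrightarrow> int m dvd z"
proof
  assume "root_char m z = 1"
  then obtain k :: int where "2 * pi * real_of_int z / real m = of_int k * (2 * pi)"
    by (auto simp: root_char_def cis_eq_1_iff)
  then have "real_of_int z = of_int (int m * k)"
    using assms by (simp add: field_simps)
  then show "int m dvd z"
    by (metis dvd_triv_left of_int_eq_iff)
next
  assume "int m dvd z"
  then obtain k where "z = int m * k" ..
  then have "2 * pi * real_of_int z / real m = 2 * pi * of_int k"
    using assms by simp
  then show "root_char m z = 1"
    unfolding root_char_def by (simp only: cis_multiple_2pi Ints_of_int)
qed

lemma root_char_cong:
  assumes "m > 0" "[a = b] (mod int m)"
  shows "root_char m a = root_char m b"
proof -
  have "root_char m (a - b) = 1"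
    using assms by (simp add: root_char_eq_1_iff cong_iff_dvd_diff)
  then show ?thesis
    using root_char_add[of m "a - b" b] by simp
qed

lemma sum_root_char_eq_0:
  assumes "m > 0" "\<not> int m dvd s"
  shows "(\<Sum>u<m. root_char m (int u * s)) = 0"
proof -
  have "root_char m s \<noteq> 1"
    using assms by (simp add: root_char_eq_1_iff)
  moreover have "root_char m s ^ m = 1"
    using root_char_eq_1_iff[of m "int m * s"] assms by (simp add: root_char_power)
  ultimately show ?thesis
    by (simp add: root_char_power geometric_sum)
qed

text \<open>Orthogonality of characters on the power of \<int>/m indexed by \<open>I\<close>: the
  sum over all characters factors over the coordinates, and the factor at \<open>k\<close> is a
  vanishing geometric sum.\<close>

lemma sum_root_char_PiE_eq_0:
  assumes "m > 0" "finite I" "k \<in> I" "\<not> int m dvd s k"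
  shows "(\<Sum>t\<in>I \<rightarrow>\<^sub>E {..<m}. root_char m (\<Sum>k\<in>I. int (t k) * s k)) = 0"
proof -
  have "(\<Sum>t\<in>I \<rightarrow>\<^sub>E {..<m}. root_char m (\<Sum>k\<in>I. int (t k) * s k)) =
      (\<Prod>k\<in>I. \<Sum>u<m. root_char m (int u * s k))"
    using assms by (subst prod_sum_PiE) (simp_all add: root_char_sum)
  also have "\<dots> = 0"
    using assms sum_root_char_eq_0 by (intro prod_zero) auto
  finally show ?thesis .
qed

section \<open>Pigeonhole and greedy choice of values\<close>

lemma exists_popular_value:
  fixes f :: "'a \<Rightarrow> 'b"
  assumes "finite S" "finite V" "V \<noteq> {}" "f ` S \<subseteq> V"
  shows "\<exists>a\<in>V. real (card S) / real (card V) \<le> real (card {t\<in>S. f t = a})"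
proof (rule ccontr)
  assume "\<not> ?thesis"
  then have "\<And>a. a \<in> V \<Longrightarrow> real (card {t\<in>S. f t = a}) < real (card S) / real (card V)"
    by force
  then have "(\<Sum>a\<in>V. real (card {t\<in>S. f t = a})) < (\<Sum>a\<in>V. real (card S) / real (card V))"
    using assms by (intro sum_strict_mono) auto
  also have "\<dots> = real (card S)"
    using assms by simp
  also have "\<dots> = (\<Sum>a\<in>V. real (card {t\<in>S. f t = a}))"
    using sum.group[OF assms(1,2,4), of "\<lambda>_. 1::nat"] by (simp flip: of_nat_sum)
  finally show False
    by simp
qed

text \<open>Greedy choice: for each new \<open>j\<close>, take as \<open>a j\<close> the most
  popular value among those \<open>t\<close> that have avoided all earlier choices. This removes at
  least the fraction \<open>1 / card V\<close> of them.\<close>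

lemma exists_values_avoided_rarely:
  fixes f :: "'a \<Rightarrow> 'b \<Rightarrow> 'c"
  assumes "finite J" "finite T" "finite V" "V \<noteq> {}" "\<And>t j. f t j \<in> V"
  shows "\<exists>a. real (card {t\<in>T. \<forall>j\<in>J. f t j \<noteq> a j})
    \<le> real (card T) * (1 - 1 / real (card V)) ^ card J"
  using assms(1)
proof (induction J)
  case empty
  then show ?case by simp
next
  case (insert j J)
  then obtain a where a: "real (card {t\<in>T. \<forall>j\<in>J. f t j \<noteq> a j})
      \<le> real (card T) * (1 - 1 / real (card V)) ^ card J"
    by blast
  define S where "S = {t\<in>T. \<forall>j\<in>J. f t j \<noteq> a j}"
  have "finite S"
    using assms by (simp add: S_def)
  then obtain b where b: "real (card S) / real (card V) \<le> real (card {t\<in>S. f t j = b})"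
    using exists_popular_value[of S V "\<lambda>t. f t j"] assms by blast
  have eq: "{t\<in>T. \<forall>i\<in>insert j J. f t i \<noteq> (a(j := b)) i} = S - {t\<in>S. f t j = b}"
    using insert.hyps by (auto simp: S_def)
  have "real (card (S - {t\<in>S. f t j = b})) = real (card S) - real (card {t\<in>S. f t j = b})"
    using \<open>finite S\<close> by (subst card_Diff_subset) (auto simp: of_nat_diff card_mono)
  also have "\<dots> \<le> real (card S) * (1 - 1 / real (card V))"
    using b by (simp add: algebra_simps)
  also have "\<dots> \<le> (real (card T) * (1 - 1 / real (card V)) ^ card J) * (1 - 1 / real (card V))"
  proof (rule mult_right_mono)
    have "real (card V) \<ge> 1"
      using assms by (simp add: Suc_le_eq card_gt_0_iff)
    then show "0 \<le> 1 - 1 / real (card V)"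
      by simp
  qed (use a S_def in auto)
  finally show ?case
    using insert.hyps eq by (intro exI[of _ "a(j := b)"]) (simp add: mult_ac)
qed

section \<open>Nonempty zero-sum subsets\<close>

text \<open>
  If no nonempty subset of the columns sums to zero, then the sum over all characters \<open>\<chi>\<close> of
  \<open>\<Prod>j. (\<zeta>\<^sub>j - \<chi> (w\<^sub>j))\<close> is nonzero, whatever the roots of unity \<open>\<zeta>\<^sub>j\<close> are. Choosing the \<open>\<zeta>\<^sub>j\<close>
  greedily makes every single summand vanish.
\<close>

lemma exists_zero_sum_subset:
  fixes w :: "'k \<Rightarrow> 'j \<Rightarrow> int"
  assumes "m > 1" "finite I" "finite J" "J \<noteq> {}"
    and large: "real (card J) \<ge> real m * real (card I) * ln (real m)"
  shows "\<exists>A\<subseteq>J. A \<noteq> {} \<and> (\<forall>k\<in>I. int m dvd (\<Sum>j\<in>A. w k j))"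
proof (rule ccontr)
  assume no: "\<not> ?thesis"
  \<comment> \<open>\<open>T\<close> indexes the characters, and
    \<open>root_char m (\<phi> t j)\<close> is the value of the character \<open>t\<close> at column
    \<open>j\<close>.\<close>
  define T where "T = I \<rightarrow>\<^sub>E {..<m}"
  define \<phi> where "\<phi> t j = (\<Sum>k\<in>I. int (t k) * w k j)" for t j
  have "finite T" "card T = m ^ card I"
    using assms by (simp_all add: T_def finite_PiE card_PiE)
  obtain a where a: "real (card {t\<in>T. \<forall>j\<in>J. \<phi> t j mod int m \<noteq> a j})
      \<le> real (card T) * (1 - 1 / real m) ^ card J"
    using exists_values_avoided_rarely[of J T "{0..<int m}" "\<lambda>t j. \<phi> t j mod int m"]
      assms \<open>finite T\<close> by auto
  have "real (card T) * (1 - 1 / real m) ^ card J < 1"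
  proof -
    \<comment> \<open>The inequality is strict and \<open>J\<close> is nonempty, so the product is
      strictly below 1 even at the threshold, and the number of characters that avoid every
      \<open>a j\<close> is 0.\<close>
    have "1 - 1 / real m < exp (- 1 / real m)"
      using exp_minus_greater[of "1 / real m"] assms by simp
    then have "(1 - 1 / real m) ^ card J < exp (- 1 / real m) ^ card J"
      using assms by (intro power_strict_mono) (auto simp: card_gt_0_iff)
    also have "\<dots> = exp (- (real (card J) / real m))"
      by (simp flip: exp_of_nat_mult)
    also have "\<dots> \<le> exp (- (real (card I) * ln (real m)))"
      using large assms by (simp add: field_simps)
    also have "\<dots> = 1 / real (card T)"
      using assms \<open>card T = _\<close> by (simp add: exp_minus exp_of_nat_mult inverse_eq_divide)
    finally show ?thesis
      using assms \<open>card T = _\<close> by (simp add: field_simps)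
  qed
  with a have "card {t\<in>T. \<forall>j\<in>J. \<phi> t j mod int m \<noteq> a j} = 0"
    by linarith
  then have hit: "\<exists>j\<in>J. \<phi> t j mod int m = a j" if "t \<in> T" for t
    using \<open>finite T\<close> that by auto
  have vanish: "(\<Prod>j\<in>J. root_char m (a j) - root_char m (\<phi> t j)) = 0" if "t \<in> T" for t
  proof -
    from hit[OF that] obtain j where "j \<in> J" "\<phi> t j mod int m = a j"
      by blast
    then have "root_char m (a j) = root_char m (\<phi> t j)"
      using assms by (intro root_char_cong) (auto simp: cong_def simp flip: \<open>_ = a j\<close>)
    then show ?thesis
      using \<open>j \<in> J\<close> assms by (intro prod_zero) auto
  qed
  \<comment> \<open>The product over \<open>A\<close> is the character \<open>t\<close> at the sum
    of the columns in \<open>A\<close>, which is nonzero in the group by \<open>no\<close>.\<close>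
  have orth: "(\<Sum>t\<in>T. \<Prod>j\<in>A. root_char m (\<phi> t j)) = 0" if A: "A \<subseteq> J" "A \<noteq> {}" for A
  proof -
    from no A obtain k where "k \<in> I" "\<not> int m dvd (\<Sum>j\<in>A. w k j)"
      by blast
    moreover have "(\<Sum>j\<in>A. \<phi> t j) = (\<Sum>k\<in>I. int (t k) * (\<Sum>j\<in>A. w k j))" for t
      unfolding \<phi>_def sum_distrib_left by (rule sum.swap)
    ultimately show ?thesis
      using sum_root_char_PiE_eq_0[of m I k "\<lambda>k. \<Sum>j\<in>A. w k j"] assms
      by (simp add: T_def flip: root_char_sum)
  qed
  have "0 = (\<Sum>t\<in>T. \<Prod>j\<in>J. root_char m (a j) - root_char m (\<phi> t j))"
    using vanish by simp
  \<comment> \<open>Expand the product over subsets of \<open>J\<close>; by \<open>orth\<close> only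
    the empty subset survives, and it contributes a nonzero multiple of
    \<open>card T\<close>.\<close>
  also have "\<dots> = (\<Sum>A\<in>Pow J. \<Sum>t\<in>T. (-1) ^ card A *
      (\<Prod>j\<in>A. root_char m (\<phi> t j)) * (\<Prod>j\<in>J - A. root_char m (a j)))"
    using assms by (subst sum.swap) (simp add: prod_diff_conv_sum)
  also have "\<dots> = (\<Sum>A\<in>Pow J. (-1) ^ card A * (\<Prod>j\<in>J - A. root_char m (a j)) *
      (\<Sum>t\<in>T. \<Prod>j\<in>A. root_char m (\<phi> t j)))"
    by (simp add: sum_distrib_left mult_ac)
  also have "\<dots> = (\<Sum>A\<in>{{}}. (-1) ^ card A * (\<Prod>j\<in>J - A. root_char m (a j)) *
      (\<Sum>t\<in>T. \<Prod>j\<in>A. root_char m (\<phi> t j)))"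
    using assms orth by (intro sum.mono_neutral_right) auto
  also have "\<dots> = (\<Prod>j\<in>J. root_char m (a j)) * of_nat (card T)"
    by simp
  also have "\<dots> \<noteq> 0"
    using assms \<open>card T = _\<close> by simp
  finally show False
    by simp
qed

section \<open>Solutions as subsets of columns\<close>

text \<open>The right-hand side \<open>b\<close> is arbitrary because fixing a coordinate to 1 moves
  its column to the right, so the induction on \<open>J\<close> leaves the homogeneous case.\<close>

definition subset_sum_solutions ::
  "nat \<Rightarrow> 'k set \<Rightarrow> ('k \<Rightarrow> 'j \<Rightarrow> int) \<Rightarrow> 'j set \<Rightarrow> ('k \<Rightarrow> int) \<Rightarrow> 'j set set"
  where "subset_sum_solutions m I w J b =
    {A. A \<subseteq> J \<and> (\<forall>k\<in>I. [(\<Sum>j\<in>A. w k j) = b k] (mod int m))}"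

lemma finite_subset_sum_solutions: "finite J \<Longrightarrow> finite (subset_sum_solutions m I w J b)"
  by (rule finite_subset[of _ "Pow J"]) (auto simp: subset_sum_solutions_def)

text \<open>
  Reversing the signs of the columns in \<open>A\<close> turns \<open>A\<close> into the empty solution of the homogeneous
  system, so a nonempty zero-sum subset \<open>B\<close> for the new signs yields the second solution
  \<open>(A - B) \<union> (B - A)\<close>.
\<close>

lemma exists_second_subset_sum_solution:
  fixes w :: "'k \<Rightarrow> 'j \<Rightarrow> int"
  assumes "m > 1" "finite I" "finite J" "J \<noteq> {}"
    and "real (card J) \<ge> real m * real (card I) * ln (real m)"
    and A: "A \<in> subset_sum_solutions m I w J b"
  shows "\<exists>A'\<in>subset_sum_solutions m I w J b. A' \<noteq> A"
proof -
  define w' where "w' k j = (if j \<in> A then - w k j else w k j)" for k j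
  obtain B where B: "B \<subseteq> J" "B \<noteq> {}" "\<And>k. k \<in> I \<Longrightarrow> int m dvd (\<Sum>j\<in>B. w' k j)"
    using exists_zero_sum_subset[OF assms(1-5), of w'] by blast
  have fin: "finite A" "finite B"
    using A B assms finite_subset by (auto simp: subset_sum_solutions_def)
  have sum: "(\<Sum>j\<in>(A - B) \<union> (B - A). w k j) = (\<Sum>j\<in>A. w k j) + (\<Sum>j\<in>B. w' k j)" for k
  proof -
    have "(\<Sum>j\<in>B. w' k j) = (\<Sum>j\<in>B \<inter> A. w' k j) + (\<Sum>j\<in>B - A. w' k j)"
      using fin by (subst sum.Int_Diff[of B _ A]) auto
    moreover have "(\<Sum>j\<in>B \<inter> A. w' k j) = - (\<Sum>j\<in>A \<inter> B. w k j)"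
      by (simp add: w'_def sum_negf Int_commute)
    moreover have "(\<Sum>j\<in>B - A. w' k j) = (\<Sum>j\<in>B - A. w k j)"
      by (intro sum.cong) (auto simp: w'_def)
    moreover have "(\<Sum>j\<in>A. w k j) = (\<Sum>j\<in>A \<inter> B. w k j) + (\<Sum>j\<in>A - B. w k j)"
      using fin by (subst sum.Int_Diff[of A _ B]) auto
    moreover have "(\<Sum>j\<in>(A - B) \<union> (B - A). w k j) = (\<Sum>j\<in>A - B. w k j) + (\<Sum>j\<in>B - A. w k j)"
      using fin by (intro sum.union_disjoint) auto
    ultimately show ?thesis
      by simp
  qed
  have "[(\<Sum>j\<in>(A - B) \<union> (B - A). w k j) = b k] (mod int m)" if "k \<in> I" for k
  proof -
    have "[(\<Sum>j\<in>A. w k j) + (\<Sum>j\<in>B. w' k j) = b k + 0] (mod int m)"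
      using A B(3)[OF that] that
      by (intro cong_add) (auto simp: subset_sum_solutions_def cong_0_iff)
    then show ?thesis
      by (simp add: sum)
  qed
  moreover have "(A - B) \<union> (B - A) \<subseteq> J" "(A - B) \<union> (B - A) \<noteq> A"
    using A B by (auto simp: subset_sum_solutions_def)
  ultimately show ?thesis
    by (intro bexI[of _ "(A - B) \<union> (B - A)"]) (auto simp: subset_sum_solutions_def)
qed

text \<open>Split by membership of \<open>j\<close>; deleting \<open>j\<close> from a solution that
  contains it subtracts its column from the right-hand side.\<close>

lemma card_subset_sum_solutions_insert:
  assumes "finite J" "j \<notin> J"
  shows "card (subset_sum_solutions m I w (insert j J) b) =
    card (subset_sum_solutions m I w J b) +
    card (subset_sum_solutions m I w J (\<lambda>k. b k - w k j))"
proof -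
  let ?S = "subset_sum_solutions m I w J b"
  let ?S' = "subset_sum_solutions m I w J (\<lambda>k. b k - w k j)"
  have shift: "[(\<Sum>i\<in>insert j A. w k i) = b k] (mod int m) \<longleftrightarrow>
      [(\<Sum>i\<in>A. w k i) = b k - w k j] (mod int m)" if "A \<subseteq> J" for A k
    using that assms finite_subset[OF that]
    by (subst sum.insert) (auto simp: cong_iff_dvd_diff algebra_simps)
  have "subset_sum_solutions m I w (insert j J) b = ?S \<union> insert j ` ?S'"
  proof (intro equalityI subsetI)
    fix A assume A: "A \<in> subset_sum_solutions m I w (insert j J) b"
    show "A \<in> ?S \<union> insert j ` ?S'"
    proof (cases "j \<in> A")
      case True
      have "A - {j} \<subseteq> J" "insert j (A - {j}) = A"
        using A True by (auto simp: subset_sum_solutions_def)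
      then have "A - {j} \<in> ?S'"
        using A shift[of "A - {j}"] by (auto simp: subset_sum_solutions_def)
      then show ?thesis
        using \<open>insert j (A - {j}) = A\<close> by blast
    qed (use A in \<open>auto simp: subset_sum_solutions_def\<close>)
  next
    fix A assume "A \<in> ?S \<union> insert j ` ?S'"
    then show "A \<in> subset_sum_solutions m I w (insert j J) b"
      using shift by (auto simp: subset_sum_solutions_def)
  qed
  moreover have "?S \<inter> insert j ` ?S' = {}"
    using assms by (auto simp: subset_sum_solutions_def)
  moreover have "inj_on (insert j) ?S'"
    using assms by (auto simp: inj_on_def subset_sum_solutions_def dest!: subsetD)
  ultimately show ?thesis
    using assms by (simp add: card_Un_disjoint finite_subset_sum_solutions card_image)
qed

section \<open>Olson's halving argument\<close>

text \<open>
  Two distinct solutions differ in some coordinate \<open>j\<close>, so both choices for \<open>j\<close> leave a solvable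
  system in the remaining coordinates.
\<close>

lemma card_subset_sum_solutions_ge:
  fixes w :: "'k \<Rightarrow> 'j \<Rightarrow> int"
  assumes "m > 1" "finite I" "finite J" "subset_sum_solutions m I w J b \<noteq> {}"
  shows "real (card (subset_sum_solutions m I w J b))
    \<ge> 2 powr (real (card J) - real m * real (card I) * ln (real m))"
  using assms(3,4)
proof (induction "card J" arbitrary: J b rule: less_induct)
  case less
  define c where "c = real m * real (card I) * ln (real m)"
  have "c \<ge> 0"
    using assms by (simp add: c_def)
  show ?case
  proof (cases "J \<noteq> {} \<and> real (card J) \<ge> c")
    \<comment> \<open>Below the threshold the exponent is not positive, so the one given solution is
      enough; for empty \<open>J\<close> this rests on \<open>c \<ge> 0\<close>.\<close>
    case False
    then have "real (card J) - c \<le> 0"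
      using \<open>c \<ge> 0\<close> by auto
    then have "2 powr (real (card J) - c) \<le> 2 powr 0"
      by (intro powr_mono) auto
    also have "\<dots> \<le> real (card (subset_sum_solutions m I w J b))"
      using less.prems by (simp add: Suc_le_eq card_gt_0_iff finite_subset_sum_solutions)
    finally show ?thesis
      by (simp add: c_def)
  next
    case True
    obtain A where A: "A \<in> subset_sum_solutions m I w J b"
      using less.prems by blast
    then obtain A' where A': "A' \<in> subset_sum_solutions m I w J b" "A' \<noteq> A"
      using exists_second_subset_sum_solution[OF assms(1,2) less.prems(1)] True
      unfolding c_def by blast
    \<comment> \<open>\<open>C\<close> and \<open>D\<close> are \<open>A\<close> and
      \<open>A'\<close> in the order that puts \<open>j\<close> in the second one; \<open>C\<close>
      then solves the half without \<open>j\<close>, and \<open>D - {j}\<close> the half with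
      \<open>j\<close>.\<close>
    obtain C D j where CD: "C \<in> subset_sum_solutions m I w J b"
        "D \<in> subset_sum_solutions m I w J b" "j \<notin> C" "j \<in> D"
      using A A' by blast
    define K where "K = J - {j}"
    have K: "J = insert j K" "j \<notin> K" "finite K"
      using CD less.prems by (auto simp: K_def subset_sum_solutions_def)
    then have card: "card J = Suc (card K)"
      by simp
    have "C \<in> subset_sum_solutions m I w K b"
      using CD by (auto simp: K_def subset_sum_solutions_def)
    then have 1: "2 powr (real (card K) - c) \<le> real (card (subset_sum_solutions m I w K b))"
      using less.hyps[of K b] card K by (auto simp: c_def)
    have "subset_sum_solutions m I w K (\<lambda>k. b k - w k j) \<noteq> {}"
    proof -
      have "D - {j} \<subseteq> K" "finite D"
        using CD K finite_subset[of D J] less.prems by (auto simp: subset_sum_solutions_def)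
      then have "D - {j} \<in> subset_sum_solutions m I w K (\<lambda>k. b k - w k j)"
        using CD by (auto simp: subset_sum_solutions_def sum_diff1 intro!: cong_diff)
      then show ?thesis by blast
    qed
    then have 2: "2 powr (real (card K) - c)
        \<le> real (card (subset_sum_solutions m I w K (\<lambda>k. b k - w k j)))"
      using less.hyps[of K "\<lambda>k. b k - w k j"] card K by (auto simp: c_def)
    have "2 powr (real (card J) - c) = 2 * 2 powr (real (card K) - c)"
      using powr_add[of "2::real" 1 "real (card K) - c"] by (simp add: card algebra_simps)
    then show ?thesis
      using 1 2 K card_subset_sum_solutions_insert[OF K(3,2), of m I w b] by (simp add: c_def)
  qed
qed

section \<open>From prime power moduli to the single modulus m\<close>

lemma finite_exactly_divides:
  assumes "m > 0"
  shows "finite {q. q \<parallel> m}"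
  by (rule finite_subset[of _ "{..m}"]) (use assms in \<open>auto simp: exactly_divides_def dvd_imp_le\<close>)

text \<open>
  Multiplying a congruence modulo \<open>q\<close> by \<open>m div q\<close> makes it a congruence modulo \<open>m\<close>.
\<close>

lemma card_solutions_eq:
  assumes "m > 0"
  shows "card (solutions m n rq v) =
    card (subset_sum_solutions m (SIGMA q:{q. q \<parallel> m}. {1..rq q})
      (\<lambda>(q, i) j. int (m div q) * v q i j) {1..n} (\<lambda>_. 0))"
    (is "_ = card ?S")
proof -
  have scale: "int m dvd int (m div q) * z \<longleftrightarrow> int q dvd z" if "q \<parallel> m" for q z
  proof -
    have "q dvd m"
      using that by (auto simp: exactly_divides_def)
    then have "int m = int (m div q) * int q" "int (m div q) \<noteq> 0"
      using assms by (auto simp flip: of_nat_mult)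
    then show ?thesis
      by (metis dvd_mult_cancel_left)
  qed
  have sum: "(\<Sum>j=1..n. v q i j * x j) = (\<Sum>j | j \<in> {1..n} \<and> x j = 1. v q i j)"
    if "x \<in> {1..n} \<rightarrow>\<^sub>E {0, 1}" for x q i
    using that by (subst sum.mono_neutral_right[of "{1..n}" "{j. j \<in> {1..n} \<and> x j = 1}"]) auto
  have mem: "x \<in> solutions m n rq v \<longleftrightarrow> {j. j \<in> {1..n} \<and> x j = 1} \<in> ?S"
    if "x \<in> {1..n} \<rightarrow>\<^sub>E {0, 1}" for x
    unfolding solutions_def subset_sum_solutions_def mem_Collect_eq sum[OF that]
    using that by (auto simp: cong_0_iff scale simp flip: sum_distrib_left)
  \<comment> \<open>A 0-1 vector corresponds to its support; extensionality makes this
    injective.\<close>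
  have "bij_betw (\<lambda>x. {j. j \<in> {1..n} \<and> x j = 1}) (solutions m n rq v) ?S"
  proof (rule bij_betwI')
    fix x y assume "x \<in> solutions m n rq v" "y \<in> solutions m n rq v"
    then have xy: "x \<in> {1..n} \<rightarrow>\<^sub>E {0, 1}" "y \<in> {1..n} \<rightarrow>\<^sub>E {0, 1}"
      by (auto simp: solutions_def)
    show "({j. j \<in> {1..n} \<and> x j = 1} = {j. j \<in> {1..n} \<and> y j = 1}) = (x = y)"
    proof
      assume *: "{j. j \<in> {1..n} \<and> x j = 1} = {j. j \<in> {1..n} \<and> y j = 1}"
      show "x = y"
      proof (rule PiE_ext[OF xy])
        fix j assume "j \<in> {1..n}"
        then have "x j = 1 \<longleftrightarrow> y j = 1"
          using * by blast
        then show "x j = y j"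
          using \<open>j \<in> {1..n}\<close> PiE_mem[OF xy(1), of j] PiE_mem[OF xy(2), of j] by auto
      qed
    qed simp
  next
    fix x assume "x \<in> solutions m n rq v"
    then show "{j. j \<in> {1..n} \<and> x j = 1} \<in> ?S"
      using mem by (auto simp: solutions_def)
  next
    fix A assume A: "A \<in> ?S"
    define x where "x = (\<lambda>j\<in>{1..n}. if j \<in> A then 1 else 0 :: int)"
    have "x \<in> {1..n} \<rightarrow>\<^sub>E {0, 1}" "A = {j. j \<in> {1..n} \<and> x j = 1}"
      using A by (auto simp: x_def subset_sum_solutions_def)
    then show "\<exists>x\<in>solutions m n rq v. A = {j. j \<in> {1..n} \<and> x j = 1}"
      using A mem by blast
  qed
  then show ?thesis
    by (rule bij_betw_same_card)
qed

section \<open>The two bounds\<close>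

text \<open>The second bound can fail in the excluded cases. For \<open>n = 1\<close> the exponent
  is 1, but a nonzero coefficient leaves only the zero vector. For \<open>n = m = 2\<close> the
  exponent is about 1.04 if \<open>r = 1\<close> and 0.08 if \<open>r = 2\<close>, but
  \<open>r\<close> independent vectors leave only 2 or 1 solutions.\<close>

theorem theorem3p3:
  fixes m n r :: nat
    and rq :: "nat \<Rightarrow> nat"
    and v :: "nat \<Rightarrow> nat \<Rightarrow> nat \<Rightarrow> int"
  assumes "m > 1"
    and "n \<ge> 1"
    and "r = (\<Sum>q | q \<parallel> m. rq q)"
  shows "(real n \<ge> real m * real r * ln (real m) \<longrightarrow> card (solutions m n rq v) \<ge> 2) \<and>
    (\<not> (r \<ge> 1 \<and> n = 1) \<and> \<not> (r \<in> {1, 2} \<and> n = 2 \<and> m = 2) \<longrightarrow>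
      real (card (solutions m n rq v))
        \<ge> 2 powr (real n - real m * real r * ln (real m) * ln (real n)))"
proof -
  define I where "I = (SIGMA q:{q. q \<parallel> m}. {1..rq q})"
  define w where "w = (\<lambda>(q, i) j. int (m div q) * v q i j)"
  define S where "S = subset_sum_solutions m I w {1..n} (\<lambda>_. 0)"
  define c where "c = real m * real r * ln (real m)"
  have I: "finite I" "card I = r"
    using assms finite_exactly_divides[of m] by (simp_all add: I_def)
  have card: "card (solutions m n rq v) = card S"
    using card_solutions_eq assms by (simp add: S_def I_def w_def)
  have "finite S" "{} \<in> S"
    by (simp_all add: S_def finite_subset_sum_solutions) (simp add: subset_sum_solutions_def)
  then have "card S \<ge> 1"
    by (auto simp: Suc_le_eq card_gt_0_iff)
  have "card S \<ge> 2" if large: "real n \<ge> c"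
  proof -
    obtain A where "A \<in> S" "A \<noteq> {}"
      using exists_second_subset_sum_solution[of m I "{1..n}" "{}" w "\<lambda>_. 0"]
        \<open>m > 1\<close> \<open>n \<ge> 1\<close> I large \<open>{} \<in> S\<close> by (auto simp: S_def c_def)
    then have "card {{}, A} \<le> card S"
      using \<open>{} \<in> S\<close> \<open>finite S\<close> by (intro card_mono) auto
    then show ?thesis
      using \<open>A \<noteq> {}\<close> by simp
  qed
  moreover have "real (card S) \<ge> 2 powr (real n - c * ln (real n))"
    if small: "\<not> (r \<ge> 1 \<and> n = 1)" "\<not> (r \<in> {1, 2} \<and> n = 2 \<and> m = 2)"
  proof -
    have "c \<ge> 0"
      using \<open>m > 1\<close> by (simp add: c_def)
    have bound: "real (card S) \<ge> 2 powr (real n - c)"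
      using card_subset_sum_solutions_ge[of m I "{1..n}" w "\<lambda>_. 0"] assms I \<open>{} \<in> S\<close>
      by (auto simp: S_def c_def)
    \<comment> \<open>For \<open>r = 0\<close> both exponents are \<open>n\<close>, and for
      \<open>n \<ge> 3\<close> the factor \<open>ln n \<ge> 1\<close> weakens \<open>bound\<close>.
      For \<open>n = 2\<close> that factor is below 1, so the claim is shown to be trivial
      instead.\<close>
    consider "r = 0" | "r \<ge> 1" "n = 2" | "n \<ge> 3"
      using assms small by linarith
    then show ?thesis
    proof cases
      case 1
      then show ?thesis
        using bound by (simp add: c_def)
    next
      case 2
      have ln2: "ln 2 \<ge> (2 / 3 :: real)"
        by (rule ln2_ge_two_thirds)
      \<comment> \<open>The constant 3 is what makes
        \<open>c * ln 2 \<ge> 3 * (2 / 3) = 2 = n\<close>, so that the exponent is not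
        positive.\<close>
      have "c \<ge> 3"
      proof (cases "m = 2")
        case True
        then have "r \<ge> 3"
          using 2 small by auto
        then have "real r * ln 2 \<ge> 3 * (2 / 3)"
          using ln2 by (intro mult_mono) auto
        then show ?thesis
          using True by (simp add: c_def)
      next
        case False
        then have "m \<ge> 3"
          using assms by simp
        then have "ln (real m) \<ge> 1"
          using exp_le by (subst ln_ge_iff) auto
        moreover have "real m * real r \<ge> 3 * 1"
          using \<open>m \<ge> 3\<close> 2 by (intro mult_mono) auto
        ultimately have "real m * real r * ln (real m) \<ge> 3 * 1"
          using mult_mono[of 3 "real m * real r" 1 "ln (real m)"] by simp
        then show ?thesis
          by (simp add: c_def)
      qed
      then have "c * ln 2 \<ge> 3 * (2 / 3)"
        using ln2 by (intro mult_mono) auto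
      then have "2 powr (real n - c * ln (real n)) \<le> 2 powr 0"
        using 2 by (intro powr_mono) auto
      then show ?thesis
        using \<open>card S \<ge> 1\<close> by simp
    next
      case 3
      have "exp 1 \<le> real n"
        using exp_le 3 by linarith
      then have "ln (real n) \<ge> 1"
        using 3 by (simp add: ln_ge_iff)
      then have "c \<le> c * ln (real n)"
        using \<open>c \<ge> 0\<close> by (simp add: mult_le_cancel_left1)
      then have "2 powr (real n - c * ln (real n)) \<le> 2 powr (real n - c)"
        by (intro powr_mono) auto
      then show ?thesis
        using bound by linarith
    qed
  qed
  ultimately show ?thesis
    unfolding card c_def by blast
qed

end
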